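(* Let $Q_n$ be the $n$-dimensional hypercube graph. Then $\mathrm{UUSN}(Q_n) < 3n + O(\log n)$ as $n\to\infty$; that is, there exist constants $C>0$ and $n_0$ such that $\mathrm{UUSN}(Q_n) < 3n + C\log n$ for all $n\ge n_0$.
   Context: Graphs are finite, simple and undirected. The hypercube $Q_n$ has the $2^n$ subsets of $\{1,\dots,n\}$ as vertices, two being adjacent when their symmetric difference has exactly one element. A valid labelling of a graph $G$ with universe a finite set $S$ assigns to the vertices of $G$ pairwise distinct nonempty subsets of $S$ such that two distinct vertices are adjacent if and only if their labels are disjoint. A valid labelling is uniform if all vertex labels have the same number of elements. The uniform universe size number $\mathrm{UUSN}(G)$ is the minimum of $|S|$ over all finite sets $S$ for which $G$ has a uniform valid labelling with universe $S$. *)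

theory Defs
  imports Complex_Main "Graph_Theory.Pair_Digraph"
begin

text \<open>
  A finite simple undirected graph is a \<^locale>\<open>pair_graph\<close>: the arc relation is finite,
  irreflexive and symmetric, and an undirected edge is a pair of opposite arcs.
\<close>

definition hypercube :: "nat \<Rightarrow> nat set pair_pre_digraph" where
  "hypercube n =
    \<lparr> pverts = Pow {1..n},
      parcs = {(A, B). A \<in> Pow {1..n} \<and> B \<in> Pow {1..n} \<and> card (sym_diff A B) = 1} \<rparr>"

definition valid_labelling :: "'a pair_pre_digraph \<Rightarrow> 'b set \<Rightarrow> ('a \<Rightarrow> 'b set) \<Rightarrow> bool" where
  "valid_labelling G S L \<longleftrightarrow>
    finite S \<and>
    (\<forall>v\<in>pverts G. L v \<subseteq> S \<and> L v \<noteq> {}) \<and>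
    inj_on L (pverts G) \<and>
    (\<forall>u\<in>pverts G. \<forall>v\<in>pverts G. u \<noteq> v \<longrightarrow> ((u, v) \<in> parcs G \<longleftrightarrow> L u \<inter> L v = {}))"

definition uniform_labelling :: "'a pair_pre_digraph \<Rightarrow> ('a \<Rightarrow> 'b set) \<Rightarrow> bool" where
  "uniform_labelling G L \<longleftrightarrow> (\<exists>k. \<forall>v\<in>pverts G. card (L v) = k)"

text \<open>
  Taking the universes to be sets of natural numbers loses nothing (lemma \<open>UUSN_le\<close>), and the
  minimum is attained for every finite simple graph (lemma \<open>UUSN_attained\<close>).
\<close>

definition UUSN :: "'a pair_pre_digraph \<Rightarrow> nat" where
  "UUSN G = (LEAST m. \<exists>(S :: nat set) L.
      card S = m \<and> valid_labelling G S L \<and> uniform_labelling G L)"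

lemma pair_graph_hypercube: "pair_graph (hypercube n)"
proof
  show "finite (parcs (hypercube n))"
    by (rule finite_subset[of _ "Pow {1..n} \<times> Pow {1..n}"]) (auto simp: hypercube_def)
  show "symmetric (hypercube n)"
    by (auto simp: symmetric_def hypercube_def with_proj_def arcs_ends_def arc_to_ends_def
        sym_def Un_commute)
qed (auto simp: hypercube_def)

lemma relabel_nat:
  fixes S :: "'b set"
  assumes "valid_labelling G S L" "uniform_labelling G L"
  shows "\<exists>(T :: nat set) M. card T = card S \<and> valid_labelling G T M \<and> uniform_labelling G M"
proof -
  have fin: "finite S" and sub: "\<And>v. v \<in> pverts G \<Longrightarrow> L v \<subseteq> S"
    using assms(1) by (auto simp: valid_labelling_def)
  obtain f :: "'b \<Rightarrow> nat" where f: "inj_on f S"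
    using ex_bij_betw_finite_nat[OF fin] by (auto simp: bij_betw_def)
  define M where "M = (\<lambda>v. f ` L v)"
  have inj: "inj_on M (pverts G)"
  proof (rule inj_onI)
    fix u v assume uv: "u \<in> pverts G" "v \<in> pverts G" "M u = M v"
    then have "L u = L v"
      using inj_on_image_eq_iff[OF f sub sub] by (auto simp: M_def)
    then show "u = v"
      using assms(1) uv by (auto simp: valid_labelling_def inj_on_def)
  qed
  have disj: "M u \<inter> M v = {} \<longleftrightarrow> L u \<inter> L v = {}" if "u \<in> pverts G" "v \<in> pverts G" for u v
    using inj_on_image_Int[OF f sub[OF that(1)] sub[OF that(2)]] by (metis M_def image_is_empty)
  have "valid_labelling G (f ` S) M"
    using assms(1) inj disj sub fin by (simp add: valid_labelling_def M_def image_mono)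
  moreover have "card (M v) = card (L v)" if "v \<in> pverts G" for v
    using card_image[OF inj_on_subset[OF f sub[OF that]]] by (simp add: M_def)
  then have "uniform_labelling G M"
    using assms(2) by (auto simp: uniform_labelling_def)
  moreover have "card (f ` S) = card S"
    using f by (rule card_image)
  ultimately show ?thesis by blast
qed

lemma UUSN_le:
  fixes S :: "'b set"
  assumes "valid_labelling G S L" "uniform_labelling G L"
  shows "UUSN G \<le> card S"
  unfolding UUSN_def by (rule Least_le) (rule relabel_nat[OF assms])

lemma uniform_valid_labelling_exists:
  fixes G :: "'a pair_pre_digraph"
  assumes "pair_graph G"
  shows "\<exists>(S :: ('a set + 'a \<times> nat) set) L. valid_labelling G S L \<and> uniform_labelling G L"
proof -
  interpret pair_graph G by fact
  have fin: "finite (pverts G)" by (rule pair_finite_verts)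
  define N where "N = card (pverts G)"
  define D where "D v = {w \<in> pverts G. w \<noteq> v \<and> (v, w) \<notin> parcs G}" for v
  define A :: "'a \<Rightarrow> ('a set + 'a \<times> nat) set"
    where "A v = (\<lambda>w. Inl {v, w}) ` D v" for v
  define B :: "'a \<Rightarrow> ('a set + 'a \<times> nat) set"
    where "B v = (\<lambda>i. Inr (v, i)) ` {..<N - card (D v)}" for v
  define L where "L v = A v \<union> B v" for v
  have finD: "finite (D v)" for v using fin by (auto simp: D_def)
  have ltN: "card (D v) < N" if "v \<in> pverts G" for v
    unfolding N_def using fin that by (intro psubset_card_mono) (auto simp: D_def)
  have cA: "card (A v) = card (D v)" for v
    unfolding A_def by (rule card_image) (auto simp: inj_on_def doubleton_eq_iff)
  have cB: "card (B v) = N - card (D v)" for v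
    unfolding B_def by (subst card_image) (auto simp: inj_on_def)
  have finAB: "finite (A v)" "finite (B v)" for v
    using finD by (auto simp: A_def B_def)
  have cL: "card (L v) = N" if "v \<in> pverts G" for v
    unfolding L_def using ltN[OF that] finAB
    by (subst card_Un_disjoint) (auto simp: cA cB, auto simp: A_def B_def)
  have mem: "Inr (v, 0) \<in> L v" if "v \<in> pverts G" for v
    using ltN[OF that] by (auto simp: L_def B_def)
  have nmem: "Inr (v, 0) \<notin> L u" if "u \<noteq> v" for u v
    using that by (auto simp: L_def A_def B_def)
  have sym: "(u, v) \<in> parcs G \<Longrightarrow> (v, u) \<in> parcs G" for u v
    using pair_sym_arcs by (auto simp: symmetric_def elim: symE)
  have adj: "(u, v) \<in> parcs G \<longleftrightarrow> L u \<inter> L v = {}"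
    if "u \<in> pverts G" "v \<in> pverts G" "u \<noteq> v" for u v
  proof
    assume "(u, v) \<in> parcs G"
    with sym[OF this] that show "L u \<inter> L v = {}"
      by (auto simp: L_def A_def B_def D_def doubleton_eq_iff)
  next
    assume dis: "L u \<inter> L v = {}"
    show "(u, v) \<in> parcs G"
    proof (rule ccontr)
      assume n: "(u, v) \<notin> parcs G"
      then have "(v, u) \<notin> parcs G" using sym by blast
      with n that have "v \<in> D u" "u \<in> D v" by (auto simp: D_def)
      then have "Inl {u, v} \<in> L u" "Inl {v, u} \<in> L v"
        by (simp_all add: L_def A_def image_iff) (metis, metis)
      then have "Inl {u, v} \<in> L u \<inter> L v"
        by (simp add: insert_commute)
      with dis show False by blast
    qed
  qed
  have "inj_on L (pverts G)"
    using mem nmem by (intro inj_onI) metis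
  moreover have "\<forall>v\<in>pverts G. L v \<subseteq> \<Union> (L ` pverts G) \<and> L v \<noteq> {}"
    using mem by blast
  moreover have "finite (\<Union> (L ` pverts G))"
    using fin finAB by (auto simp: L_def)
  ultimately have "valid_labelling G (\<Union> (L ` pverts G)) L"
    unfolding valid_labelling_def using adj by (intro conjI ballI impI) auto
  moreover have "uniform_labelling G L"
    using cL by (auto simp: uniform_labelling_def)
  ultimately show ?thesis by (intro exI conjI)
qed

lemma UUSN_attained:
  assumes "pair_graph G"
  shows "\<exists>(S :: nat set) L.
    card S = UUSN G \<and> valid_labelling G S L \<and> uniform_labelling G L"
proof -
  obtain S :: "('a set + 'a \<times> nat) set" and L
    where "valid_labelling G S L" "uniform_labelling G L"
    using uniform_valid_labelling_exists[OF assms] by blast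
  from relabel_nat[OF this]
  have "\<exists>m. \<exists>(S :: nat set) L. card S = m \<and> valid_labelling G S L \<and> uniform_labelling G L"
    by blast
  then show ?thesis
    unfolding UUSN_def by (rule LeastI_ex)
qed

end

theory Submission
  imports Defs
begin

text \<open>
  Write \<open>w = card x\<close>. Along an edge of the cube the cardinality changes by one, so its residue
  modulo 3 tells which endpoint is the smaller set. The coordinate elements record, for each
  \<open>i\<close>, the residue \<open>w\<close> if \<open>i \<in> x\<close> and \<open>w - 1\<close> otherwise; if \<open>card y \<equiv> w + 1\<close>, two such labels
  share the element at \<open>i\<close> exactly when \<open>i \<in> x - y\<close>, so they are disjoint iff \<open>x \<subseteq> y\<close>. It remains
  to enforce \<open>card y = w + 1\<close> exactly, and comparing binary digits of \<open>w + 1\<close> and \<open>card y\<close> does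
  this with logarithmically many further elements. Each label contains one element per
  coordinate and two per binary digit, so the labelling is uniform.
\<close>

text \<open>
  The coordinate 0 counts as a member of every vertex, which makes labels of vertices
  with congruent cardinalities meet. Adding 2 stands for subtracting 1 modulo 3.
\<close>

definition coord_label :: "nat \<Rightarrow> nat set \<Rightarrow> ((nat + nat \<times> bool) \<times> nat) set" where
  "coord_label n x =
    (\<lambda>i. (Inl i, (card x + (if i \<in> insert 0 x then 0 else 2)) mod 3)) ` {0..n}"

definition digit_label :: "nat \<Rightarrow> (nat \<Rightarrow> bool) \<Rightarrow> nat \<Rightarrow> ((nat + nat \<times> bool) \<times> nat) set" where
  "digit_label J p c = (\<lambda>j. (Inr (j, p j), c)) ` {..<J}"

text \<open>The negation turns equality of digits into disjointness. For
  \<open>w' \<equiv> w + 1\<close> modulo 3, the negated digits of \<open>w'\<close> carry the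
  residue of \<open>w\<close>, as do the digits of \<open>Suc w\<close>, so the two families meet
  wherever the digits of \<open>Suc w\<close> and \<open>w'\<close> differ.\<close>

definition size_label :: "nat \<Rightarrow> nat \<Rightarrow> ((nat + nat \<times> bool) \<times> nat) set" where
  "size_label J w =
    digit_label J (bit (Suc w)) (w mod 3) \<union> digit_label J (\<lambda>j. \<not> bit w j) ((w + 2) mod 3)"

definition cube_label :: "nat \<Rightarrow> nat \<Rightarrow> nat set \<Rightarrow> ((nat + nat \<times> bool) \<times> nat) set" where
  "cube_label n J x = coord_label n x \<union> size_label J (card x)"

definition cube_universe :: "nat \<Rightarrow> nat \<Rightarrow> ((nat + nat \<times> bool) \<times> nat) set" where
  "cube_universe n J = ({0..n} <+> {..<J} \<times> UNIV) \<times> {..<3}"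

lemma finite_cube_universe: "finite (cube_universe n J)"
  by (simp add: cube_universe_def)

lemma card_cube_universe: "card (cube_universe n J) = 3 * (n + 1 + 2 * J)"
  by (simp add: cube_universe_def card_Plus card_cartesian_product)

lemma cube_label_subset: "cube_label n J x \<subseteq> cube_universe n J"
  by (auto simp: cube_label_def coord_label_def size_label_def digit_label_def cube_universe_def)

lemma digit_label_disjoint_iff:
  "digit_label J p c \<inter> digit_label J q d = {} \<longleftrightarrow> c \<noteq> d \<or> (\<forall>j<J. p j \<noteq> q j)"
  by (auto simp: digit_label_def)

lemma coord_size_label_disjoint: "coord_label n x \<inter> size_label J w = {}"
  by (auto simp: coord_label_def size_label_def digit_label_def)

lemma cube_label_nonempty: "cube_label n J x \<noteq> {}"
  by (simp add: cube_label_def coord_label_def)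

lemma card_cube_label: "card (cube_label n J x) = n + 1 + 2 * J"
proof -
  have "card (coord_label n x) = n + 1"
    unfolding coord_label_def by (subst card_image) (auto simp: inj_on_def)
  moreover have "card (size_label J (card x)) = J + J"
  proof -
    have digit: "card (digit_label J p c) = J" "finite (digit_label J p c)" for p c
      by (simp_all add: digit_label_def card_image inj_on_def)
    \<comment> \<open>Different residues keep the two digit families apart even where their digit
      entries coincide, so their cardinalities add.\<close>
    have "card x mod 3 \<noteq> (card x + 2) mod 3" by presburger
    then show ?thesis
      unfolding size_label_def
      by (subst card_Un_disjoint) (simp_all only: digit digit_label_disjoint_iff simp_thms)
  qed
  moreover have "finite (coord_label n x)" "finite (size_label J (card x))"
    by (simp_all add: coord_label_def size_label_def digit_label_def)
  ultimately show ?thesis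
    unfolding cube_label_def by (subst card_Un_disjoint) (auto simp: coord_size_label_disjoint)
qed

lemma nat_eq_if_bits_eq:
  fixes a b :: nat
  assumes "a < 2 ^ J" "b < 2 ^ J" "\<And>j. j < J \<Longrightarrow> bit a j = bit b j"
  shows "a = b"
proof -
  have "take_bit J a = take_bit J b"
    by (rule bit_eqI) (auto simp: bit_take_bit_iff assms(3))
  then show ?thesis
    using assms(1,2) by (simp add: take_bit_nat_eq_self)
qed

text \<open>Only the residue of \<open>card x\<close> can occur in both labels: at the members of
  \<open>x\<close> in one and at the nonmembers of \<open>y\<close> in the other.\<close>

lemma coord_label_disjoint_iff:
  assumes "x \<subseteq> {1..n}" and res: "card y mod 3 = Suc (card x) mod 3"
  shows "coord_label n x \<inter> coord_label n y = {} \<longleftrightarrow> x \<subseteq> y"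
proof -
  have ne: "card x mod 3 \<noteq> card y mod 3" "(card x + 2) mod 3 \<noteq> card y mod 3"
    "(card x + 2) mod 3 \<noteq> (card y + 2) mod 3" and eq: "card x mod 3 = (card y + 2) mod 3"
    using res by presburger+
  have "coord_label n x \<inter> coord_label n y = {} \<longleftrightarrow>
      (\<forall>i\<in>{0..n}. (card x + (if i \<in> insert 0 x then 0 else 2)) mod 3 \<noteq>
        (card y + (if i \<in> insert 0 y then 0 else 2)) mod 3)"
    unfolding coord_label_def by blast
  also have "\<dots> \<longleftrightarrow> (\<forall>i\<in>{0..n}. i \<in> x \<longrightarrow> i \<in> insert 0 y)"
    using ne eq by (intro ball_cong) auto
  also have "\<dots> \<longleftrightarrow> x \<subseteq> y"
  proof -
    \<comment> \<open>Since 0 is not in \<open>x\<close>, the artificial coordinate imposes no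
      condition.\<close>
    have "i \<in> {0..n} \<and> i \<noteq> 0" if "i \<in> x" for i
      using that assms(1) by auto
    then show ?thesis by blast
  qed
  finally show ?thesis .
qed

text \<open>Of the four pairs of digit families only one has matching residues. The bounds ensure
  that \<open>J\<close> digits determine both numbers.\<close>

lemma size_label_disjoint_iff:
  assumes "Suc v < 2 ^ J" "w < 2 ^ J" and res: "w mod 3 = Suc v mod 3"
  shows "size_label J v \<inter> size_label J w = {} \<longleftrightarrow> w = Suc v"
proof -
  have ne: "v mod 3 \<noteq> w mod 3" "(v + 2) mod 3 \<noteq> w mod 3"
    "(v + 2) mod 3 \<noteq> (w + 2) mod 3" and eq: "v mod 3 = (w + 2) mod 3"
    using res by presburger+
  have "size_label J v \<inter> size_label J w = {} \<longleftrightarrow> (\<forall>j<J. bit (Suc v) j = bit w j)"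
    unfolding size_label_def Int_Un_distrib Int_Un_distrib2 Un_empty digit_label_disjoint_iff
    using ne eq by blast
  also have "\<dots> \<longleftrightarrow> w = Suc v"
    using nat_eq_if_bits_eq[OF assms(1,2)] by auto
  finally show ?thesis .
qed

lemma cube_label_disjoint_step:
  assumes "x \<subseteq> {1..n}" "Suc (card x) < 2 ^ J" "card y < 2 ^ J"
    and "card y mod 3 = Suc (card x) mod 3"
  shows "cube_label n J x \<inter> cube_label n J y = {} \<longleftrightarrow> x \<subseteq> y \<and> card y = Suc (card x)"
proof -
  have "cube_label n J x \<inter> cube_label n J y = {} \<longleftrightarrow>
      coord_label n x \<inter> coord_label n y = {} \<and>
      size_label J (card x) \<inter> size_label J (card y) = {}"
    unfolding cube_label_def using coord_size_label_disjoint by blast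
  then show ?thesis
    using coord_label_disjoint_iff[OF assms(1,4)] size_label_disjoint_iff[OF assms(2,3,4)]
    by simp
qed

lemma cube_label_meet:
  assumes "card x mod 3 = card y mod 3"
  shows "cube_label n J x \<inter> cube_label n J y \<noteq> {}"
proof -
  have "(Inl 0, card x mod 3) \<in> cube_label n J u" if "card u mod 3 = card x mod 3" for u
    using that by (force simp: cube_label_def coord_label_def)
  then show ?thesis
    using assms by fastforce
qed

text \<open>Two residues modulo 3 are equal or cyclically consecutive. In each case the residues
  rule out every alternative on the right that the earlier lemmas do not decide.\<close>

lemma cube_label_disjoint_iff:
  assumes "x \<subseteq> {1..n}" "y \<subseteq> {1..n}" "n + 1 < 2 ^ J"
  shows "cube_label n J x \<inter> cube_label n J y = {} \<longleftrightarrow>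
    (x \<subseteq> y \<and> card y = Suc (card x)) \<or> (y \<subseteq> x \<and> card x = Suc (card y))"
proof -
  have bound: "Suc (card u) < 2 ^ J" "card u < 2 ^ J" if "u \<subseteq> {1..n}" for u
  proof -
    have "card u \<le> n"
      using card_mono[OF finite_atLeastAtMost that] by simp
    with assms(3) show "Suc (card u) < 2 ^ J" "card u < 2 ^ J" by linarith+
  qed
  have "card x mod 3 = card y mod 3 \<or> card y mod 3 = Suc (card x) mod 3 \<or>
      card x mod 3 = Suc (card y) mod 3"
  proof -
    have "m mod 3 = 0 \<or> m mod 3 = 1 \<or> m mod 3 = 2" for m :: nat by presburger
    from this[of "card x"] this[of "card y"] show ?thesis by (auto simp: mod_Suc)
  qed
  then consider "card x mod 3 = card y mod 3" | "card y mod 3 = Suc (card x) mod 3"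
    | "card x mod 3 = Suc (card y) mod 3"
    by blast
  then show ?thesis
  proof cases
    case 1
    then have "card y \<noteq> Suc (card x)" "card x \<noteq> Suc (card y)" by presburger+
    with cube_label_meet[OF 1] show ?thesis by blast
  next
    case 2
    then have "card x \<noteq> Suc (card y)" by presburger
    with cube_label_disjoint_step[OF assms(1) bound(1)[OF assms(1)] bound(2)[OF assms(2)] 2]
    show ?thesis by blast
  next
    case 3
    then have "card y \<noteq> Suc (card x)" by presburger
    with cube_label_disjoint_step[OF assms(2) bound(1)[OF assms(2)] bound(2)[OF assms(1)] 3]
    show ?thesis by blast
  qed
qed

lemma card_sym_diff_eq_1_iff:
  assumes "finite x" "finite y"
  shows "card (sym_diff x y) = 1 \<longleftrightarrow>
    (x \<subseteq> y \<and> card y = Suc (card x)) \<or> (y \<subseteq> x \<and> card x = Suc (card y))"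
proof -
  have "card (sym_diff x y) = card (x - y) + card (y - x)"
    using assms by (intro card_Un_disjoint) auto
  moreover have "card x = card (x - y) + card (x \<inter> y)" "card y = card (y - x) + card (x \<inter> y)"
    using card_Int_Diff[of x y] card_Int_Diff[of y x] assms by (simp_all add: Int_commute)
  moreover have "x \<subseteq> y \<longleftrightarrow> card (x - y) = 0" "y \<subseteq> x \<longleftrightarrow> card (y - x) = 0"
    using assms by auto
  ultimately show ?thesis by linarith
qed

text \<open>Coordinate 0 reveals the cardinality modulo 3; once this is known, the residue at
  \<open>i\<close> reveals whether \<open>i\<close> is a member.\<close>

lemma inj_on_cube_label: "inj_on (cube_label n J) (Pow {1..n})"
proof (rule inj_onI)
  fix x y assume sub: "x \<in> Pow {1..n}" "y \<in> Pow {1..n}"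
    and eq: "cube_label n J x = cube_label n J y"
  have mem: "(Inl i, c) \<in> cube_label n J u \<longleftrightarrow>
      i \<le> n \<and> c = (card u + (if i \<in> insert 0 u then 0 else 2)) mod 3" for i c u
    by (auto simp: cube_label_def coord_label_def size_label_def digit_label_def)
  have coord: "(card x + (if i \<in> insert 0 x then 0 else 2)) mod 3 =
      (card y + (if i \<in> insert 0 y then 0 else 2)) mod 3" if "i \<le> n" for i
    using mem[of i _ x] mem[of i _ y] that eq by blast
  have res: "card x mod 3 = card y mod 3"
    using coord[of 0] by simp
  then have ne: "card x mod 3 \<noteq> (card y + 2) mod 3" "(card x + 2) mod 3 \<noteq> card y mod 3"
    by presburger+
  have "i \<in> x \<longleftrightarrow> i \<in> y" if "i \<in> {1..n}" for i
    using coord[of i] that ne by (auto split: if_splits)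
  with sub show "x = y" by blast
qed

lemma UUSN_hypercube_le:
  assumes "n + 1 < 2 ^ J"
  shows "UUSN (hypercube n) \<le> 3 * (n + 1 + 2 * J)"
proof -
  have "(x, y) \<in> parcs (hypercube n) \<longleftrightarrow> cube_label n J x \<inter> cube_label n J y = {}"
    if "x \<in> Pow {1..n}" "y \<in> Pow {1..n}" for x y
  proof -
    have "finite x" "finite y"
      using that by (auto intro: finite_subset)
    from card_sym_diff_eq_1_iff[OF this] show ?thesis
      using that cube_label_disjoint_iff[of x n y J] assms by (simp add: hypercube_def)
  qed
  then have "valid_labelling (hypercube n) (cube_universe n J) (cube_label n J)"
    unfolding valid_labelling_def
    using finite_cube_universe cube_label_subset cube_label_nonempty inj_on_cube_label
    by (simp add: hypercube_def)
  moreover have "uniform_labelling (hypercube n) (cube_label n J)"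
    by (auto simp: uniform_labelling_def card_cube_label)
  ultimately show ?thesis
    using UUSN_le card_cube_universe by metis
qed

theorem theorem26:
  shows "\<exists>C::real. C > 0 \<and> (\<exists>n0::nat. \<forall>n\<ge>n0.
    real (UUSN (hypercube n)) < 3 * real n + C * ln (real n))"
proof -
  \<comment> \<open>With \<open>J \<le> 2 * ln n + 2\<close>, the excess \<open>3 + 6 * J\<close> is
    at most \<open>15 + 12 * ln n\<close>, hence at most \<open>27 * ln n\<close> once
    \<open>ln n \<ge> 1\<close>; 28 makes the bound strict. The condition \<open>n \<ge> 3\<close>
    gives \<open>n > e\<close>.\<close>
  have "real (UUSN (hypercube n)) < 3 * real n + 28 * ln (real n)" if n: "n \<ge> 3" for n
  proof -
    have ln_n: "ln (real n) \<ge> 1"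
      using n exp_le by (subst ln_ge_iff) auto
    have ln_2: "ln 2 \<ge> (1/2 :: real)"
      using ln_le_minus_one[of "1/2 :: real"] by (simp add: ln_div)
    \<comment> \<open>One unit above the floor makes the power of 2 exceed \<open>n\<close>; the
      second doubles it, which leaves room for \<open>n + 1\<close>.\<close>
    define J where "J = nat \<lfloor>log 2 (real n)\<rfloor> + 2"
    have log_ge: "log 2 (real n) \<ge> 0" using n by simp
    have "real n < 2 powr (real J - 1)"
      using n log_ge unfolding J_def by (subst log_less_iff[symmetric]) (auto, linarith)
    also have "\<dots> = 2 ^ (J - 1)"
      by (subst powr_realpow[symmetric]) (auto simp: J_def)
    finally have "n < 2 ^ (J - 1)"
      by (metis of_nat_less_iff of_nat_numeral of_nat_power)
    moreover have "(2::nat) ^ J = 2 * 2 ^ (J - 1)"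
      by (simp add: J_def)
    ultimately have "n + 1 < 2 ^ J" using n by linarith
    then have "real (UUSN (hypercube n)) \<le> real (3 * (n + 1 + 2 * J))"
      using UUSN_hypercube_le of_nat_le_iff by blast
    moreover have "real J \<le> log 2 (real n) + 2"
      using log_ge by (simp add: J_def)
    moreover have "log 2 (real n) \<le> 2 * ln (real n)"
      using ln_n ln_2 mult_left_mono[OF ln_2, of "2 * ln (real n)"]
      by (simp add: log_def divide_simps)
    ultimately show ?thesis using ln_n by simp
  qed
  then show ?thesis by (intro exI[of _ 28] conjI exI[of _ 3]) auto
qed

end
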